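(* Let $X$ be a Banach space with the approximation property, let $n$ be a positive odd integer, and let $P,Q$ be two (bounded linear) projections on $X$ such that $(P-Q)^n$ is nuclear. Then $$\operatorname{tr}\,(P-Q)^n=\dim E_{10}-\dim\tilde E_{01}=\dim\tilde E_{10}-\dim E_{01},$$ where $E_{ab}=\{x\in X: Px=ax,\ Qx=bx\}$ and $\tilde E_{ab}=\{x^*\in X^*: P^*x^*=ax^*,\ Q^*x^*=bx^*\}$.
   Context: A projection on a Banach space $X$ is a bounded linear operator $P:X\to X$ with $P^2=P$. $X^*$ is the dual space and $P^*,Q^*$ are the adjoint operators on $X^*$. An operator $T:X\to X$ is nuclear if it can be written as $T=\sum_{k=1}^\infty A_k$ where each $A_k$ is a rank one bounded operator and $\sum_{k=1}^\infty\|A_k\|<\infty$. For a rank one operator $A=x^*\otimes x$ (i.e. $Ay=x^*(y)x$), $\operatorname{tr} A=x^*(x)$. When $X$ has the approximation property, the trace of a nuclear operator $T$ is defined by $\operatorname{tr} T=\sum_{k=1}^\infty \operatorname{tr} A_k$, and this value does not depend on the chosen representation $T=\sum_{k=1}^\infty A_k$ with each $A_k$ a rank one bounded operator and $\sum_{k=1}^\infty\|A_k\|<\infty$. *)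

theory Defs
  imports "HOL-Analysis.Analysis"
begin

text \<open>
  Real and complex Banach spaces are treated uniformly. The scalars form a field of sort
  \<open>{real_normed_field, euclidean_space}\<close>: this has both \<^typ>\<open>real\<close> and \<^typ>\<open>complex\<close> as
  instances, and by Frobenius there are no others up to isomorphism. The type class \<^class>\<open>banach\<close>
  supplies the norm, completeness and the underlying real structure; \<open>smul\<close> is the
  multiplication by scalars of the field. For real scalars it is forced to be \<open>scaleR\<close>.
\<close>

locale banach_over = vector_space smul
  for smul :: "'k::{real_normed_field,euclidean_space} \<Rightarrow> 'a::banach \<Rightarrow> 'a" +
  assumes norm_scale: "norm (smul c x) = norm c * norm x"
    and scale_of_real: "smul (of_real r) x = r *\<^sub>R x"

text \<open>
  The type of \<open>blinfun\<close> only records real linearity, so linearity over the scalar field is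
  imposed separately. The operator norm does not depend on this distinction.
\<close>

definition bounded_ops ::
  "('k::{real_normed_field,euclidean_space} \<Rightarrow> 'a::banach \<Rightarrow> 'a) \<Rightarrow> ('a \<Rightarrow>\<^sub>L 'a) set" where
  "bounded_ops smul = {T. \<forall>c x. blinfun_apply T (smul c x) = smul c (blinfun_apply T x)}"

definition dual_space ::
  "('k::{real_normed_field,euclidean_space} \<Rightarrow> 'a::banach \<Rightarrow> 'a) \<Rightarrow> ('a \<Rightarrow>\<^sub>L 'k) set" where
  "dual_space smul = {f. \<forall>c x. blinfun_apply f (smul c x) = c * blinfun_apply f x}"

definition dual_scale ::
  "'k::{real_normed_field,euclidean_space} \<Rightarrow> ('a::banach \<Rightarrow>\<^sub>L 'k) \<Rightarrow> ('a \<Rightarrow>\<^sub>L 'k)" where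
  "dual_scale c f = blinfun_mult_right c o\<^sub>L f"

definition adjoint_op ::
  "('a::banach \<Rightarrow>\<^sub>L 'a) \<Rightarrow> ('a \<Rightarrow>\<^sub>L 'k::{real_normed_field,euclidean_space}) \<Rightarrow> ('a \<Rightarrow>\<^sub>L 'k)" where
  "adjoint_op T f = f o\<^sub>L T"

definition projection ::
  "('k::{real_normed_field,euclidean_space} \<Rightarrow> 'a::banach \<Rightarrow> 'a) \<Rightarrow> ('a \<Rightarrow>\<^sub>L 'a) \<Rightarrow> bool" where
  "projection smul P \<longleftrightarrow> P \<in> bounded_ops smul \<and> P o\<^sub>L P = P"

primrec op_power :: "('a::banach \<Rightarrow>\<^sub>L 'a) \<Rightarrow> nat \<Rightarrow> ('a \<Rightarrow>\<^sub>L 'a)" where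
  "op_power T 0 = id_blinfun"
| "op_power T (Suc n) = T o\<^sub>L op_power T n"

text \<open>
  \<^const>\<open>vector_space.dim\<close> is \<open>0\<close> on infinite-dimensional subspaces, so finite-dimensionality
  has to be stated separately.
\<close>

definition finite_dim ::
  "('k::field \<Rightarrow> 'v::ab_group_add \<Rightarrow> 'v) \<Rightarrow> 'v set \<Rightarrow> bool" where
  "finite_dim smul V \<longleftrightarrow> (\<exists>B. finite B \<and> V \<subseteq> module.span smul B)"

definition approximation_property ::
  "('k::{real_normed_field,euclidean_space} \<Rightarrow> 'a::banach \<Rightarrow> 'a) \<Rightarrow> bool" where
  "approximation_property smul \<longleftrightarrow>
     (\<forall>K e. compact K \<and> e > 0 \<longrightarrow>
        (\<exists>T \<in> bounded_ops smul. finite_dim smul (range (blinfun_apply T)) \<and>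
           (\<forall>x\<in>K. norm (blinfun_apply T x - x) \<le> e)))"

definition rank_one ::
  "('k::{real_normed_field,euclidean_space} \<Rightarrow> 'a::banach \<Rightarrow> 'a) \<Rightarrow> ('a \<Rightarrow>\<^sub>L 'a) \<Rightarrow> bool" where
  "rank_one smul A \<longleftrightarrow>
     A \<in> bounded_ops smul \<and> vector_space.dim smul (range (blinfun_apply A)) = 1"

definition rank_one_trace ::
  "('k::{real_normed_field,euclidean_space} \<Rightarrow> 'a::banach \<Rightarrow> 'a) \<Rightarrow> ('a \<Rightarrow>\<^sub>L 'a) \<Rightarrow> 'k" where
  "rank_one_trace smul A =
     (THE t. \<exists>f \<in> dual_space smul. \<exists>x.
        (\<forall>y. blinfun_apply A y = smul (blinfun_apply f y) x) \<and> t = blinfun_apply f x)"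

definition nuclear_representation ::
  "('k::{real_normed_field,euclidean_space} \<Rightarrow> 'a::banach \<Rightarrow> 'a) \<Rightarrow>
     (nat \<Rightarrow> 'a \<Rightarrow>\<^sub>L 'a) \<Rightarrow> ('a \<Rightarrow>\<^sub>L 'a) \<Rightarrow> bool" where
  "nuclear_representation smul A T \<longleftrightarrow>
     (\<forall>k. rank_one smul (A k)) \<and> summable (\<lambda>k. norm (A k)) \<and> A sums T"

definition nuclear ::
  "('k::{real_normed_field,euclidean_space} \<Rightarrow> 'a::banach \<Rightarrow> 'a) \<Rightarrow> ('a \<Rightarrow>\<^sub>L 'a) \<Rightarrow> bool" where
  "nuclear smul T \<longleftrightarrow> (\<exists>A. nuclear_representation smul A T)"

text \<open>Meaningful only under the approximation property, which makes the value unique.\<close>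

definition nuclear_trace ::
  "('k::{real_normed_field,euclidean_space} \<Rightarrow> 'a::banach \<Rightarrow> 'a) \<Rightarrow> ('a \<Rightarrow>\<^sub>L 'a) \<Rightarrow> 'k" where
  "nuclear_trace smul T =
     (THE t. \<exists>A. nuclear_representation smul A T \<and> (\<lambda>k. rank_one_trace smul (A k)) sums t)"

definition joint_eigenspace ::
  "('k::{real_normed_field,euclidean_space} \<Rightarrow> 'a::banach \<Rightarrow> 'a) \<Rightarrow>
     ('a \<Rightarrow>\<^sub>L 'a) \<Rightarrow> ('a \<Rightarrow>\<^sub>L 'a) \<Rightarrow> 'k \<Rightarrow> 'k \<Rightarrow> 'a set" where
  "joint_eigenspace smul P Q a b =
     {x. blinfun_apply P x = smul a x \<and> blinfun_apply Q x = smul b x}"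

definition dual_joint_eigenspace ::
  "('k::{real_normed_field,euclidean_space} \<Rightarrow> 'a::banach \<Rightarrow> 'a) \<Rightarrow>
     ('a \<Rightarrow>\<^sub>L 'a) \<Rightarrow> ('a \<Rightarrow>\<^sub>L 'a) \<Rightarrow> 'k \<Rightarrow> 'k \<Rightarrow> ('a \<Rightarrow>\<^sub>L 'k) set" where
  "dual_joint_eigenspace smul P Q a b =
     {f \<in> dual_space smul. adjoint_op P f = dual_scale a f \<and> adjoint_op Q f = dual_scale b f}"

end

theory Submission
  imports Defs
begin

text \<open>
  Put \<open>A = P - Q\<close>, \<open>W = 1 - P - Q\<close>, \<open>U = QP\<close> and \<open>K = A\<^sup>n\<^sup>+\<^sup>1\<close>. Everything rests on the identities
  \<open>A\<^sup>2 + W\<^sup>2 = 1\<close> and \<open>AW = - WA\<close>; in particular \<open>A\<^sup>2\<close> commutes with \<open>P\<close> and \<open>Q\<close>. Write \<open>E\<^sub>1\<^sub>0\<close> for the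
  joint eigenspace of \<open>P, Q\<close> and \<open>E'\<^sub>0\<^sub>1\<close> for that of the adjoints.

  Since \<open>n\<close> is odd, \<open>W A\<^sup>n W = - A\<^sup>n W\<^sup>2\<close>, and cyclicity of the trace gives
  \<open>tr (A\<^sup>n - A\<^sup>n\<^sup>+\<^sup>2) = tr (A\<^sup>n W\<^sup>2) = 0\<close>. Hence \<open>tr A\<^sup>n = tr A\<^sup>n\<^sup>+\<^sup>2 = tr (PK) - tr (QK)\<close>.

  The right hand side is the index of \<open>U\<close> as an operator from the range of \<open>P\<close> to the range of \<open>Q\<close>.
  A geometric sum \<open>C\<close> of even powers of \<open>A\<close> satisfies \<open>(1 - A\<^sup>2) C = 1 - K\<close>, so \<open>S = PCQ\<close> satisfies
  \<open>SU = P - PK\<close> and \<open>US = Q - QK\<close>: it inverts \<open>U\<close> modulo nuclear operators. The nuclear operator \<open>K\<close>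
  is a finite rank operator plus one of norm less than \<open>1\<close>, so there is also a parametrix modulo
  finite rank, and by Atkinson's argument (\<open>generalized_inverse_exists\<close>) a bounded \<open>S\<^sub>1 = P S\<^sub>1 Q\<close> with
  \<open>U S\<^sub>1 U = U\<close>. Then \<open>J = P - S\<^sub>1 U\<close> is a finite rank projection onto \<open>E\<^sub>1\<^sub>0\<close>, and \<open>L = Q - U S\<^sub>1\<close> is one
  whose adjoint fixes exactly \<open>E'\<^sub>0\<^sub>1\<close>; their traces are the two dimensions
  (\<open>finite_rank_projection\<close>). Finally \<open>S\<^sub>1 - S = S\<^sub>1 QK - JS\<close> is nuclear, so \<open>(S\<^sub>1 - S) U = PK - J\<close> and
  \<open>U (S\<^sub>1 - S) = QK - L\<close> have the same trace, that is
  \<open>tr (PK) - tr (QK) = tr J - tr L = dim E\<^sub>1\<^sub>0 - dim E'\<^sub>0\<^sub>1\<close> (\<open>trace_odd_power_difference\<close>).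
  Exchanging \<open>P\<close> and \<open>Q\<close>, which changes the sign of \<open>A\<^sup>n\<close>, gives the second formula.

  The approximation property is used only for the uniqueness of the trace
  (\<open>has_nuclear_trace_unique\<close>). Finite-dimensional subspaces need no Hahn-Banach theorem here,
  because functionals on them are extended along the finite rank operators at hand.
\<close>

section \<open>Sequences and compactness\<close>

lemma sums_interleave:
  fixes a b :: "nat \<Rightarrow> 'v::real_normed_vector"
  assumes "a sums s" "b sums t"
  shows "(\<lambda>n. if even n then a (n div 2) else b (n div 2)) sums (s + t)"
proof -
  have "(\<lambda>n. if even n then a (n div 2) else 0) sums s"
  proof (subst sums_mono_reindex[of "\<lambda>n. 2 * n", symmetric])
    show "strict_mono (\<lambda>n::nat. 2 * n)" by (simp add: strict_mono_def)
    show "(if even n then a (n div 2) else 0) = 0" if "n \<notin> range (\<lambda>n::nat. 2 * n)" for n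
      using that by (auto elim!: evenE)
  qed (use assms in simp)
  moreover have "(\<lambda>n. if even n then 0 else b (n div 2)) sums t"
  proof (subst sums_mono_reindex[of "\<lambda>n. 2 * n + 1", symmetric])
    show "strict_mono (\<lambda>n::nat. 2 * n + 1)" by (simp add: strict_mono_def)
    show "(if even n then 0 else b (n div 2)) = 0" if "n \<notin> range (\<lambda>n::nat. 2 * n + 1)" for n
      using that by (auto elim!: oddE)
  qed (use assms in simp)
  ultimately have "(\<lambda>n. (if even n then a (n div 2) else 0) + (if even n then 0 else b (n div 2)))
      sums (s + t)"
    by (rule sums_add)
  moreover have "(\<lambda>n. (if even n then a (n div 2) else 0) + (if even n then 0 else b (n div 2)))
      = (\<lambda>n. if even n then a (n div 2) else b (n div 2))"
    by auto
  ultimately show ?thesis by simp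
qed

lemma compact_range_convergent:
  fixes x :: "nat \<Rightarrow> 'v::real_normed_vector"
  assumes "x \<longlonglongrightarrow> l"
  shows "compact (insert l (range x))"
  using compactin_sequence_with_limit[of euclidean x l "range x"] assms
  by (simp add: compactin_euclidean_iff)

text \<open>
  A case of the Abel-Dini theorem: the summable sequence \<open>a\<close> stays summable after division by the square roots of
  its tails, which tend to \<open>0\<close>.
\<close>

lemma summable_div_sqrt_tail:
  fixes a :: "nat \<Rightarrow> real"
  assumes a: "summable a" "\<And>k. a k \<ge> 0"
  obtains r where "r \<longlonglongrightarrow> 0" "\<And>k. r k \<ge> 0" "\<And>k. r k = 0 \<Longrightarrow> a k = 0"
    "summable (\<lambda>k. a k / r k)"
proof -
  define t where "t k = (\<Sum>j. a (j + k))" for k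
  have sh: "summable (\<lambda>j. a (j + k))" for k using a(1) by simp
  have t_nonneg: "t k \<ge> 0" for k unfolding t_def using sh a(2) by (intro suminf_nonneg) auto
  have t_Suc: "t k = a k + t (Suc k)" for k
    using suminf_split_initial_segment[OF sh[of k], of 1] by (simp add: t_def)
  have t_lim: "t \<longlonglongrightarrow> 0" unfolding t_def by (rule suminf_exist_split2[OF a(1)])
  have "(\<lambda>k. sqrt (t k)) \<longlonglongrightarrow> 0" using tendsto_real_sqrt[OF t_lim] by simp
  moreover have "sqrt (t k) = 0 \<Longrightarrow> a k = 0" for k
    using t_Suc[of k] t_nonneg[of "Suc k"] a(2)[of k] by auto
  moreover have "summable (\<lambda>k. a k / sqrt (t k))"
  proof (rule summable_comparison_test')
    have "(\<lambda>k. sqrt (t k)) \<longlonglongrightarrow> 0" by fact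
    from telescope_summable'[OF this]
    show "summable (\<lambda>k. 2 * (sqrt (t k) - sqrt (t (Suc k))))" by (intro summable_mult)
    fix k assume "k \<ge> (0::nat)"
    show "norm (a k / sqrt (t k)) \<le> 2 * (sqrt (t k) - sqrt (t (Suc k)))"
    proof (cases "t k = 0")
      case True
      then show ?thesis using t_Suc[of k] t_nonneg[of "Suc k"] a(2)[of k] by auto
    next
      case False
      define u v where "u = sqrt (t k)" and "v = sqrt (t (Suc k))"
      have u: "u > 0" using False t_nonneg[of k] by (simp add: u_def)
      have "t k = u\<^sup>2" "t (Suc k) = v\<^sup>2" "v \<ge> 0"
        using t_nonneg by (auto simp: u_def v_def)
      then have ak: "a k = u\<^sup>2 - v\<^sup>2" using t_Suc[of k] by simp
      have "u\<^sup>2 - v\<^sup>2 \<le> 2 * (u - v) * u"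
      proof -
        have "2 * (u - v) * u - (u\<^sup>2 - v\<^sup>2) = (u - v)\<^sup>2" by (simp add: power2_eq_square algebra_simps)
        then show ?thesis using zero_le_power2[of "u - v"] by linarith
      qed
      then have "a k / u \<le> 2 * (u - v)" using u ak by (simp add: divide_le_eq)
      then show ?thesis using a(2)[of k] u by (simp add: u_def[symmetric] v_def[symmetric])
    qed
  qed
  ultimately show ?thesis using that[of "\<lambda>k. sqrt (t k)"] t_nonneg by simp
qed

section \<open>Bounded operators\<close>

lemma vector_space_dual_scale:
  "vector_space (dual_scale :: 'k::{real_normed_field,euclidean_space} \<Rightarrow> ('a::banach \<Rightarrow>\<^sub>L 'k) \<Rightarrow> _)"
  by unfold_locales
    (auto intro!: blinfun_eqI simp: dual_scale_def blinfun.bilinear_simps algebra_simps)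

lemma op_power_comm:
  fixes T S :: "'v::banach \<Rightarrow>\<^sub>L 'v"
  assumes "\<And>x. T (S x) = S (T x)"
  shows "op_power T n (S x) = S (op_power T n x)"
  by (induction n) (simp_all add: assms)

lemma norm_op_power: "norm (op_power T n) \<le> norm T ^ n"
proof (induction n)
  case 0
  then show ?case using norm_blinfun_id_le by simp
next
  case (Suc n)
  have "norm (op_power T (Suc n)) \<le> norm T * norm (op_power T n)"
    by (simp add: norm_blinfun_compose)
  also have "\<dots> \<le> norm T * norm T ^ n" using Suc by (intro mult_left_mono) auto
  finally show ?case by simp
qed

context banach_over
begin

lemma bounded_bilinear_smul: "bounded_bilinear smul"
proof
  fix r c x
  have "smul (r *\<^sub>R c) x = smul (of_real r * c) x" by (simp add: scaleR_conv_of_real)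
  also have "\<dots> = r *\<^sub>R smul c x" by (simp only: scale_scale[symmetric] scale_of_real)
  finally show "smul (r *\<^sub>R c) x = r *\<^sub>R smul c x" .
  have "smul c (r *\<^sub>R x) = smul (c * of_real r) x" by (simp add: scale_of_real[symmetric])
  also have "\<dots> = smul (of_real r * c) x" by (simp add: mult.commute)
  also have "\<dots> = r *\<^sub>R smul c x" by (simp only: scale_scale[symmetric] scale_of_real)
  finally show "smul c (r *\<^sub>R x) = r *\<^sub>R smul c x" .
  show "\<exists>K. \<forall>a b. norm (smul a b) \<le> norm a * norm b * K"
    by (rule exI[of _ 1]) (simp add: norm_scale)
qed (simp_all add: scale_left_distrib scale_right_distrib)

sublocale smul: bounded_bilinear smul by (rule bounded_bilinear_smul)

lemma dual_scale_apply [simp]: "blinfun_apply (dual_scale c f) y = c * blinfun_apply f y"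
  by (simp add: dual_scale_def)

lemma bounded_opsD: "T \<in> bounded_ops smul \<Longrightarrow> blinfun_apply T (smul c x) = smul c (blinfun_apply T x)"
  by (simp add: bounded_ops_def)

lemma dual_spaceD: "f \<in> dual_space smul \<Longrightarrow> blinfun_apply f (smul c x) = c * blinfun_apply f x"
  by (simp add: dual_space_def)

lemma bounded_ops_compose [intro]:
  "S \<in> bounded_ops smul \<Longrightarrow> T \<in> bounded_ops smul \<Longrightarrow> S o\<^sub>L T \<in> bounded_ops smul"
  by (simp add: bounded_ops_def)

lemma bounded_ops_diff [intro]:
  "S \<in> bounded_ops smul \<Longrightarrow> T \<in> bounded_ops smul \<Longrightarrow> S - T \<in> bounded_ops smul"
  by (simp add: bounded_ops_def blinfun.bilinear_simps scale_right_diff_distrib)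

lemma bounded_ops_add [intro]:
  "S \<in> bounded_ops smul \<Longrightarrow> T \<in> bounded_ops smul \<Longrightarrow> S + T \<in> bounded_ops smul"
  by (simp add: bounded_ops_def blinfun.bilinear_simps scale_right_distrib)

lemma bounded_ops_zero [intro]: "0 \<in> bounded_ops smul"
  by (simp add: bounded_ops_def)

lemma bounded_ops_id [intro]: "id_blinfun \<in> bounded_ops smul"
  by (simp add: bounded_ops_def)

lemma bounded_ops_op_power [intro]:
  "T \<in> bounded_ops smul \<Longrightarrow> op_power T n \<in> bounded_ops smul"
  by (induction n) auto

lemma bounded_ops_sum [intro]:
  "(\<And>i. i \<in> I \<Longrightarrow> T i \<in> bounded_ops smul) \<Longrightarrow> sum T I \<in> bounded_ops smul"
  by (induction I rule: infinite_finite_induct) auto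

lemma bounded_ops_sums:
  assumes "\<And>k. T k \<in> bounded_ops smul" "T sums S"
  shows "S \<in> bounded_ops smul"
  unfolding bounded_ops_def
proof (intro CollectI allI)
  fix c x
  have app: "(\<lambda>k. T k z) sums S z" for z
    using bounded_linear.sums[OF blinfun.bounded_linear_left assms(2)] .
  have "(\<lambda>k. smul c (T k x)) sums smul c (S x)"
    using bounded_linear.sums[OF smul.bounded_linear_right app] .
  then show "S (smul c x) = smul c (S x)"
    using app[of "smul c x"] bounded_opsD[OF assms(1)] sums_unique2 by auto
qed

text \<open>The inverse of \<open>1 - T\<close> is the Neumann series \<open>\<Sum> T\<^sup>k\<close>.\<close>

lemma neumann_inverse:
  assumes T: "T \<in> bounded_ops smul" "norm T < 1"
  obtains Z where "Z \<in> bounded_ops smul" "\<And>x. Z x - T (Z x) = x" "\<And>x. Z (x - T x) = x"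
proof -
  have "summable (\<lambda>k. norm (op_power T k))"
    by (rule summable_comparison_test'[OF summable_geometric[of "norm T"]])
      (use T norm_op_power in auto)
  then have "summable (op_power T)" by (rule summable_norm_cancel)
  then obtain Z where Z: "op_power T sums Z" by (auto simp: summable_def)
  have app: "(\<lambda>k. op_power T k x) sums Z x" for x
    using bounded_linear.sums[OF blinfun.bounded_linear_left Z] .
  have shift: "(\<lambda>k. op_power T (Suc k) x) sums (Z x - x)" for x
    using sums_split_initial_segment[OF app[of x], of 1] by simp
  have "(\<lambda>k. op_power T (Suc k) x) sums T (Z x)" for x
    using bounded_linear.sums[OF blinfun.bounded_linear_right app[of x]] by simp
  then have 1: "T (Z x) = Z x - x" for x using shift sums_unique2 by blast
  have "(\<lambda>k. op_power T (Suc k) x) sums Z (T x)" for x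
    using app[of "T x"] by (simp add: op_power_comm)
  then have 2: "Z (T x) = Z x - x" for x using shift sums_unique2 by blast
  show ?thesis
  proof (rule that[of Z])
    show "Z \<in> bounded_ops smul" using bounded_ops_sums[OF _ Z] T(1) by blast
  qed (simp_all add: 1 2 blinfun.diff_right)
qed

text \<open>The rank one operator \<open>y \<mapsto> g(y) x\<close>, or the zero operator if \<open>g\<close> or \<open>x\<close> vanishes.\<close>

definition tensor :: "('a \<Rightarrow>\<^sub>L 'k) \<Rightarrow> 'a \<Rightarrow> ('a \<Rightarrow>\<^sub>L 'a)" where
  "tensor g x = Blinfun (\<lambda>y. smul (g y) x)"

lemma tensor_apply [simp]: "blinfun_apply (tensor g x) y = smul (blinfun_apply g y) x"
  unfolding tensor_def
  by (subst bounded_linear_Blinfun_apply)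
    (auto intro: bounded_linear_compose[OF smul.bounded_linear_left blinfun.bounded_linear_right])

lemma tensor_bounded_ops [intro]: "g \<in> dual_space smul \<Longrightarrow> tensor g x \<in> bounded_ops smul"
  by (simp add: bounded_ops_def dual_spaceD)

lemma norm_tensor: "norm (tensor g x) \<le> norm g * norm x"
proof (rule norm_blinfun_bound)
  fix y
  have "norm (g y) * norm x \<le> norm g * norm y * norm x"
    by (intro mult_right_mono norm_blinfun) auto
  then show "norm (tensor g x y) \<le> norm g * norm x * norm y"
    by (simp add: norm_scale algebra_simps)
qed auto

lemma dual_spaceI:
  assumes add: "\<And>x y. h (x + y) = h x + h y"
    and scale: "\<And>c x. h (smul c x) = c * h x"
    and bound: "\<And>x. norm (h x) \<le> norm x * M"
  shows "bounded_linear h" and "Blinfun h \<in> dual_space smul"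
proof -
  show bl: "bounded_linear h"
  proof (rule bounded_linear_intro)
    show "h (r *\<^sub>R x) = r *\<^sub>R h x" for r x
      by (simp add: scale_of_real[symmetric] scale scaleR_conv_of_real)
  qed (use assms in auto)
  show "Blinfun h \<in> dual_space smul"
    using bl scale by (simp add: dual_space_def bounded_linear_Blinfun_apply)
qed

end

section \<open>Operators of finite rank\<close>

context banach_over
begin

text \<open>
  On the span of a finite independent set the coordinates are bounded by the norm. In the
  induction step, were the new vector \<open>y\<close> a limit of vectors \<open>v\<^sub>n\<close> of the old span, then by the
  induction hypothesis the coordinates of \<open>v\<^sub>n\<close> would converge and \<open>y\<close> would lie in the old span.
\<close>

lemma finite_independent_coords_bounded:
  assumes "finite B" "independent B"
  shows "\<exists>M. \<forall>c. \<forall>b\<in>B. norm (c b) \<le> M * norm (\<Sum>b\<in>B. smul (c b) b)"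
  using assms
proof (induction B rule: finite_induct)
  case empty
  then show ?case by simp
next
  case (insert y B)
  have indB: "independent B" using insert.prems independent_mono by blast
  have y: "y \<notin> span B" using insert by (simp add: independent_insert)
  obtain M where M: "\<And>c b. b \<in> B \<Longrightarrow> norm (c b) \<le> M * norm (\<Sum>b\<in>B. smul (c b) b)"
    using insert.IH[OF indB] by blast
  have "\<exists>d>0. \<forall>v\<in>span B. d \<le> norm (y - v)"
  proof (rule ccontr)
    assume "\<not> ?thesis"
    then have "\<exists>v\<in>span B. norm (y - v) < 1 / real (Suc n)" for n
      by (metis of_nat_0_less_iff zero_less_Suc zero_less_divide_1_iff not_le)
    then obtain v where v: "\<And>n. v n \<in> span B" "\<And>n. norm (y - v n) < 1 / real (Suc n)" by metis
    have "(\<lambda>n. y - v n) \<longlonglongrightarrow> 0"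
      by (rule Lim_null_comparison[OF _ LIMSEQ_Suc[OF lim_1_over_n]])
        (use v(2) in \<open>auto intro!: always_eventually less_imp_le\<close>)
    then have lim: "v \<longlonglongrightarrow> y" by (subst LIMSEQ_iff) (auto simp: LIMSEQ_iff norm_minus_commute)
    define c where "c n = representation B (v n)" for n
    have vc: "v n = (\<Sum>b\<in>B. smul (c n b) b)" for n
      using sum_representation_eq[OF indB v(1) insert.hyps(1) order_refl, of n] by (simp add: c_def)
    have "Cauchy (\<lambda>n. c n b)" if b: "b \<in> B" for b
    proof (rule metric_CauchyI)
      fix e :: real assume "e > 0"
      moreover have "Cauchy v" using lim LIMSEQ_imp_Cauchy by blast
      ultimately obtain N where N: "\<And>m n. m \<ge> N \<Longrightarrow> n \<ge> N \<Longrightarrow> dist (v m) (v n) < e / (\<bar>M\<bar> + 1)"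
        using metric_CauchyD[of v "e / (\<bar>M\<bar> + 1)"] by auto
      have "dist (c m b) (c n b) < e" if "m \<ge> N" "n \<ge> N" for m n
      proof -
        have "norm (c m b - c n b) \<le> M * norm (v m - v n)"
          using M[OF b, of "\<lambda>b. c m b - c n b"]
          by (simp add: vc scale_left_diff_distrib sum_subtractf)
        also have "\<dots> \<le> (\<bar>M\<bar> + 1) * norm (v m - v n)" by (intro mult_right_mono) auto
        also have "\<dots> < e" using N[OF that] by (simp add: dist_norm field_simps)
        finally show ?thesis by (simp add: dist_norm)
      qed
      then show "\<exists>N. \<forall>m\<ge>N. \<forall>n\<ge>N. dist (c m b) (c n b) < e" by blast
    qed
    then have "\<exists>l. (\<lambda>n. c n b) \<longlonglongrightarrow> l" if "b \<in> B" for b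
      using that Cauchy_convergent convergent_def by blast
    then obtain l where l: "\<And>b. b \<in> B \<Longrightarrow> (\<lambda>n. c n b) \<longlonglongrightarrow> l b" by metis
    have "(\<lambda>n. \<Sum>b\<in>B. smul (c n b) b) \<longlonglongrightarrow> (\<Sum>b\<in>B. smul (l b) b)"
      by (intro tendsto_sum smul.tendsto l tendsto_const)
    then have "y = (\<Sum>b\<in>B. smul (l b) b)" using lim LIMSEQ_unique by (simp add: vc[symmetric])
    also have "\<dots> \<in> span B" by (intro span_sum span_scale span_base)
    finally show False using y by blast
  qed
  then obtain d where d: "d > 0" "\<And>v. v \<in> span B \<Longrightarrow> d \<le> norm (y - v)" by blast
  have main: "norm (c y) \<le> 1 / d * norm (\<Sum>b\<in>insert y B. smul (c b) b) \<and>
      (\<forall>b\<in>B. norm (c b) \<le> \<bar>M\<bar> * (1 + norm y / d) * norm (\<Sum>b\<in>insert y B. smul (c b) b))" for c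
  proof -
    define w where "w = (\<Sum>b\<in>B. smul (c b) b)"
    have w: "w \<in> span B" unfolding w_def by (intro span_sum span_scale span_base)
    have s: "(\<Sum>b\<in>insert y B. smul (c b) b) = smul (c y) y + w"
      using insert.hyps by (simp add: w_def)
    have cy: "norm (c y) * d \<le> norm (smul (c y) y + w)"
    proof (cases "c y = 0")
      case False
      have "smul (c y) y + w = smul (c y) (y - smul (- inverse (c y)) w)"
        using False by (simp add: scale_right_diff_distrib scale_right_distrib)
      then have "norm (smul (c y) y + w) = norm (c y) * norm (y - smul (- inverse (c y)) w)"
        by (simp only: norm_scale)
      also have "\<dots> \<ge> norm (c y) * d" using w by (intro mult_left_mono d span_scale) auto
      finally show ?thesis .
    qed simp
    then have c1: "norm (c y) \<le> norm (smul (c y) y + w) / d" using d(1) by (simp add: le_divide_eq)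
    have "norm w \<le> norm (smul (c y) y + w) + norm (smul (c y) y)"
      using norm_triangle_ineq4[of "smul (c y) y + w" "smul (c y) y"] by simp
    also have "norm (smul (c y) y) \<le> norm (smul (c y) y + w) / d * norm y"
      unfolding norm_scale by (intro mult_right_mono c1) auto
    finally have "norm w \<le> (1 + norm y / d) * norm (smul (c y) y + w)"
      by (simp add: algebra_simps)
    then have "\<bar>M\<bar> * norm w \<le> \<bar>M\<bar> * ((1 + norm y / d) * norm (smul (c y) y + w))"
      by (intro mult_left_mono) auto
    moreover have "norm (c b) \<le> \<bar>M\<bar> * norm w" if "b \<in> B" for b
      using M[OF that, of c] mult_right_mono[OF abs_ge_self[of M], of "norm w"] by (simp add: w_def)
    ultimately show ?thesis using c1 unfolding s by (force simp: mult.assoc)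
  qed
  show ?case
  proof (intro exI allI ballI)
    fix c b assume "b \<in> insert y B"
    let ?s = "norm (\<Sum>b\<in>insert y B. smul (c b) b)"
    have "1 / d * ?s \<le> max (1 / d) (\<bar>M\<bar> * (1 + norm y / d)) * ?s"
      "\<bar>M\<bar> * (1 + norm y / d) * ?s \<le> max (1 / d) (\<bar>M\<bar> * (1 + norm y / d)) * ?s"
      by (intro mult_right_mono; simp)+
    with main[of c] \<open>b \<in> insert y B\<close>
    show "norm (c b) \<le> max (1 / d) (\<bar>M\<bar> * (1 + norm y / d)) * ?s" by force
  qed
qed

text \<open>
  The coordinates of a bounded operator of finite rank, with respect to any finite independent set
  whose span contains the range, are bounded functionals on the whole space.
\<close>

lemma finite_rank_coords:
  assumes L: "L \<in> bounded_ops smul"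
    and B: "finite B" "independent B" "range (blinfun_apply L) \<subseteq> span B"
  obtains g where "\<And>b. b \<in> B \<Longrightarrow> g b \<in> dual_space smul"
    "\<And>b y. b \<in> B \<Longrightarrow> g b y = representation B (L y) b"
    "\<And>y. L y = (\<Sum>b\<in>B. smul (g b y) b)"
proof -
  obtain M where M: "\<And>c b. b \<in> B \<Longrightarrow> norm (c b) \<le> M * norm (\<Sum>b\<in>B. smul (c b) b)"
    using finite_independent_coords_bounded[OF B(1,2)] by blast
  define h where "h b y = representation B (L y) b" for b y
  have sp: "L y \<in> span B" for y using B(3) by blast
  have rep: "(\<Sum>b\<in>B. smul (h b y) b) = L y" for y
    unfolding h_def by (rule sum_representation_eq[OF B(2) sp B(1) order_refl])
  have bound: "norm (h b y) \<le> norm y * (\<bar>M\<bar> * norm L)" if "b \<in> B" for b y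
  proof -
    have "norm (h b y) \<le> M * norm (L y)" using M[OF that, of "\<lambda>b. h b y"] by (simp add: rep)
    also have "\<dots> \<le> \<bar>M\<bar> * (norm L * norm y)"
      by (intro mult_mono norm_blinfun) auto
    finally show ?thesis by (simp add: algebra_simps)
  qed
  have add: "h b (x + y) = h b x + h b y" for b x y
    using representation_add[OF B(2) sp sp, of x y] by (simp add: h_def blinfun.add_right)
  have scale: "h b (smul c x) = c * h b x" for b c x
    using representation_scale[OF B(2) sp, of c x] by (simp add: h_def bounded_opsD[OF L])
  have ap: "blinfun_apply (Blinfun (h b)) = h b" if "b \<in> B" for b
    by (rule bounded_linear_Blinfun_apply, rule dual_spaceI[OF add scale bound[OF that]])
  show ?thesis
  proof (rule that[of "\<lambda>b. Blinfun (h b)"])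
    show "Blinfun (h b) \<in> dual_space smul" if "b \<in> B" for b
      by (rule dual_spaceI[OF add scale bound[OF that]])
  qed (use ap rep h_def in \<open>auto simp: h_def\<close>)
qed

lemma finite_dim_basis:
  assumes "finite_dim smul V" "S \<subseteq> V" "independent S"
  obtains B where "S \<subseteq> B" "B \<subseteq> V" "finite B" "independent B" "V \<subseteq> span B" "card B = dim V"
proof -
  obtain C where C: "finite C" "V \<subseteq> span C" using assms(1) by (auto simp: finite_dim_def)
  obtain B where B: "S \<subseteq> B" "B \<subseteq> V" "independent B" "V \<subseteq> span B"
    using maximal_independent_subset_extend[OF assms(2,3)] by blast
  moreover have "finite B" using independent_span_bound[OF C(1) B(3)] B(2) C(2) by blast
  moreover have "card B = dim V" using basis_card_eq_dim B by blast
  ultimately show ?thesis using that by blast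
qed

lemma finite_dim_subset: "finite_dim smul V \<Longrightarrow> W \<subseteq> V \<Longrightarrow> finite_dim smul W"
  unfolding finite_dim_def by blast

lemma finite_dim_range_compose:
  assumes "finite_dim smul (range (blinfun_apply F))" "C \<in> bounded_ops smul"
  shows "finite_dim smul (range (blinfun_apply (C o\<^sub>L F o\<^sub>L D)))"
proof -
  obtain B where B: "finite B" "range (blinfun_apply F) \<subseteq> span B"
    using assms(1) by (auto simp: finite_dim_def)
  have "module_hom smul smul (blinfun_apply C)"
    by unfold_locales (simp_all add: blinfun.add_right bounded_opsD[OF assms(2)])
  then have "span (blinfun_apply C ` B) = blinfun_apply C ` span B"
    by (rule module_hom.span_image)
  then have "range (blinfun_apply (C o\<^sub>L F o\<^sub>L D)) \<subseteq> span (blinfun_apply C ` B)"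
    using B(2) by (auto intro!: imageI)
  then show ?thesis unfolding finite_dim_def using B(1) by blast
qed

end

section \<open>Traces of nuclear operators\<close>

context banach_over
begin

text \<open>
  The relation between a nuclear operator and the trace given by one of its representations.
  Unlike in \<^const>\<open>nuclear_representation\<close>, the summands \<open>f\<^sub>k \<otimes> x\<^sub>k\<close> may vanish, so that finite rank
  operators and interleaved representations are covered directly. No approximation property is
  needed; it enters only through uniqueness of the trace.
\<close>

definition has_nuclear_trace :: "('a \<Rightarrow>\<^sub>L 'a) \<Rightarrow> 'k \<Rightarrow> bool" where
  "has_nuclear_trace T t \<longleftrightarrow> (\<exists>f x. (\<forall>k. f k \<in> dual_space smul) \<and>
     summable (\<lambda>k. norm (f k) * norm (x k)) \<and>
     (\<forall>y. (\<lambda>k. smul (blinfun_apply (f k) y) (x k)) sums blinfun_apply T y) \<and>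
     (\<lambda>k. blinfun_apply (f k) (x k)) sums t)"

lemma has_nuclear_traceI:
  fixes T :: "'a \<Rightarrow>\<^sub>L 'a" and f :: "nat \<Rightarrow> 'a \<Rightarrow>\<^sub>L 'k"
  assumes "\<And>k. f k \<in> dual_space smul" "summable (\<lambda>k. norm (f k) * norm (x k))"
    "\<And>y. (\<lambda>k. smul (f k y) (x k)) sums T y" "(\<lambda>k. f k (x k)) sums t"
  shows "has_nuclear_trace T t"
  unfolding has_nuclear_trace_def using assms by blast

lemma has_nuclear_trace_zero: "has_nuclear_trace 0 0"
  by (rule has_nuclear_traceI[where f = "\<lambda>_. 0" and x = "\<lambda>_. 0"]) (auto simp: dual_space_def)

lemma has_nuclear_trace_tensor:
  assumes "g \<in> dual_space smul"
  shows "has_nuclear_trace (tensor g x) (g x)"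
proof (rule has_nuclear_traceI[where f = "\<lambda>k. if k = 0 then g else 0" and x = "\<lambda>_. x"])
  show "(if k = 0 then g else 0) \<in> dual_space smul" for k :: nat
    using assms by (simp add: dual_space_def)
  show "summable (\<lambda>k::nat. norm (if k = 0 then g else 0) * norm x)"
    by (rule summable_finite[of "{0}"]) auto
  show "(\<lambda>k::nat. smul ((if k = 0 then g else 0) y) x) sums tensor g x y" for y
    using sums_finite[of "{0::nat}" "\<lambda>k. smul ((if k = 0 then g else 0) y) x"] by simp
  show "(\<lambda>k::nat. (if k = 0 then g else 0) x) sums g x"
    using sums_finite[of "{0::nat}" "\<lambda>k. (if k = 0 then g else 0) x"] by simp
qed

lemma has_nuclear_trace_add:
  assumes "has_nuclear_trace S s" "has_nuclear_trace T t"
  shows "has_nuclear_trace (S + T) (s + t)"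
proof -
  obtain f x where f: "\<And>k. f k \<in> dual_space smul" "summable (\<lambda>k. norm (f k) * norm (x k))"
    "\<And>y. (\<lambda>k. smul (f k y) (x k)) sums S y" "(\<lambda>k. f k (x k)) sums s"
    using assms(1) unfolding has_nuclear_trace_def by blast
  obtain g z where g: "\<And>k. g k \<in> dual_space smul" "summable (\<lambda>k. norm (g k) * norm (z k))"
    "\<And>y. (\<lambda>k. smul (g k y) (z k)) sums T y" "(\<lambda>k. g k (z k)) sums t"
    using assms(2) unfolding has_nuclear_trace_def by blast
  let ?h = "\<lambda>k. if even k then f (k div 2) else g (k div 2)"
  let ?w = "\<lambda>k. if even k then x (k div 2) else z (k div 2)"
  show ?thesis
  proof (rule has_nuclear_traceI[where f = ?h and x = ?w])
    show "?h k \<in> dual_space smul" for k using f(1) g(1) by simp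
    have "(\<lambda>k. norm (?h k) * norm (?w k)) = (\<lambda>k. if even k
        then norm (f (k div 2)) * norm (x (k div 2)) else norm (g (k div 2)) * norm (z (k div 2)))"
      by auto
    then show "summable (\<lambda>k. norm (?h k) * norm (?w k))"
      using sums_interleave[OF summable_sums[OF f(2)] summable_sums[OF g(2)]] sums_summable by auto
    have "(\<lambda>k. smul (?h k y) (?w k)) = (\<lambda>k. if even k
        then smul (f (k div 2) y) (x (k div 2)) else smul (g (k div 2) y) (z (k div 2)))" for y
      by auto
    then show "(\<lambda>k. smul (?h k y) (?w k)) sums (S + T) y" for y
      using sums_interleave[OF f(3) g(3)] by (simp add: blinfun.add_left)
    have "(\<lambda>k. ?h k (?w k)) = (\<lambda>k. if even k
        then f (k div 2) (x (k div 2)) else g (k div 2) (z (k div 2)))"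
      by auto
    then show "(\<lambda>k. ?h k (?w k)) sums (s + t)"
      using sums_interleave[OF f(4) g(4)] by simp
  qed
qed

lemma has_nuclear_trace_sum:
  "(\<And>i. i \<in> I \<Longrightarrow> has_nuclear_trace (T i) (t i)) \<Longrightarrow> has_nuclear_trace (sum T I) (sum t I)"
  by (induction I rule: infinite_finite_induct)
    (auto intro: has_nuclear_trace_zero has_nuclear_trace_add)

text \<open>
  Cyclicity of the trace: the representations \<open>(f\<^sub>k \<circ> C) \<otimes> x\<^sub>k\<close> of \<open>TC\<close> and \<open>f\<^sub>k \<otimes> C x\<^sub>k\<close> of \<open>CT\<close>
  have the common trace \<open>\<Sum> f\<^sub>k (C x\<^sub>k)\<close>.
\<close>

lemma has_nuclear_trace_cyclic:
  assumes T: "has_nuclear_trace T t" and C: "C \<in> bounded_ops smul"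
  obtains s where "has_nuclear_trace (T o\<^sub>L C) s" "has_nuclear_trace (C o\<^sub>L T) s"
proof -
  obtain f x where f: "\<And>k. f k \<in> dual_space smul" "summable (\<lambda>k. norm (f k) * norm (x k))"
    "\<And>y. (\<lambda>k. smul (f k y) (x k)) sums T y" "(\<lambda>k. f k (x k)) sums t"
    using T unfolding has_nuclear_trace_def by blast
  have sC: "summable (\<lambda>k. norm C * (norm (f k) * norm (x k)))" using f(2) by (rule summable_mult)
  have "summable (\<lambda>k. f k (C (x k)))"
  proof (rule summable_comparison_test'[OF sC])
    fix k
    have "norm (f k (C (x k))) \<le> norm (f k) * norm (C (x k))" by (rule norm_blinfun)
    also have "\<dots> \<le> norm (f k) * (norm C * norm (x k))"
      by (intro mult_left_mono norm_blinfun) auto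
    finally show "norm (f k (C (x k))) \<le> norm C * (norm (f k) * norm (x k))"
      by (simp add: algebra_simps)
  qed
  then obtain s where s: "(\<lambda>k. f k (C (x k))) sums s" by (auto simp: summable_def)
  have "has_nuclear_trace (T o\<^sub>L C) s"
  proof (rule has_nuclear_traceI[where f = "\<lambda>k. f k o\<^sub>L C" and x = x])
    show "f k o\<^sub>L C \<in> dual_space smul" for k
      using f(1) by (simp add: dual_space_def bounded_opsD[OF C])
    show "summable (\<lambda>k. norm (f k o\<^sub>L C) * norm (x k))"
    proof (rule summable_comparison_test'[OF sC])
      fix k
      have "norm (f k o\<^sub>L C) * norm (x k) \<le> (norm (f k) * norm C) * norm (x k)"
        by (intro mult_right_mono norm_blinfun_compose) auto
      then show "norm (norm (f k o\<^sub>L C) * norm (x k)) \<le> norm C * (norm (f k) * norm (x k))"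
        by (simp add: algebra_simps)
    qed
  qed (use f(3) s in auto)
  moreover have "has_nuclear_trace (C o\<^sub>L T) s"
  proof (rule has_nuclear_traceI[where f = f and x = "\<lambda>k. C (x k)"])
    show "summable (\<lambda>k. norm (f k) * norm (C (x k)))"
    proof (rule summable_comparison_test'[OF sC])
      fix k
      have "norm (f k) * norm (C (x k)) \<le> norm (f k) * (norm C * norm (x k))"
        by (intro mult_left_mono norm_blinfun) auto
      then show "norm (norm (f k) * norm (C (x k))) \<le> norm C * (norm (f k) * norm (x k))"
        by (simp add: algebra_simps)
    qed
    show "(\<lambda>k. smul (f k y) (C (x k))) sums (C o\<^sub>L T) y" for y
      using bounded_linear.sums[OF blinfun.bounded_linear_right f(3)[of y], of C]
      by (simp add: bounded_opsD[OF C])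
  qed (use f(1) s in auto)
  ultimately show ?thesis using that by blast
qed

lemma has_nuclear_trace_minus:
  assumes "has_nuclear_trace T t"
  shows "has_nuclear_trace (- T) (- t)"
proof -
  obtain f x where f: "\<And>k. f k \<in> dual_space smul" "summable (\<lambda>k. norm (f k) * norm (x k))"
    "\<And>y. (\<lambda>k. smul (f k y) (x k)) sums T y" "(\<lambda>k. f k (x k)) sums t"
    using assms unfolding has_nuclear_trace_def by blast
  show ?thesis
  proof (rule has_nuclear_traceI[where f = "\<lambda>k. - f k" and x = x])
    show "- f k \<in> dual_space smul" for k
      using f(1) by (simp add: dual_space_def blinfun.minus_left)
  qed (use f in \<open>auto simp: blinfun.minus_left intro!: sums_minus\<close>)
qed

lemma has_nuclear_trace_diff:
  "has_nuclear_trace S s \<Longrightarrow> has_nuclear_trace T t \<Longrightarrow> has_nuclear_trace (S - T) (s - t)"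
  using has_nuclear_trace_add[OF _ has_nuclear_trace_minus, of S s T t] by simp

text \<open>
  Under the approximation property the trace is unique. Rescale a representation of \<open>0\<close> such
  that \<open>\<Sum> \<parallel>f\<^sub>k\<parallel> < \<infinity>\<close> and \<open>x\<^sub>k \<longlonglongrightarrow> 0\<close>. A finite rank operator \<open>T\<close> that is
  \<open>e\<close>-close to the identity on the compact set of the \<open>x\<^sub>k\<close> changes \<open>\<Sum> f\<^sub>k x\<^sub>k\<close> by at most \<open>e \<Sum> \<parallel>f\<^sub>k\<parallel>\<close>,
  and \<open>\<Sum> f\<^sub>k (T x\<^sub>k) = 0\<close>.
\<close>

lemma has_nuclear_trace_zero_unique:
  assumes AP: "approximation_property smul" and t: "has_nuclear_trace 0 t"
  shows "t = 0"
proof -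
  obtain f x where f: "\<And>k. f k \<in> dual_space smul" "summable (\<lambda>k. norm (f k) * norm (x k))"
    "\<And>y. (\<lambda>k. smul (f k y) (x k)) sums 0" "(\<lambda>k. f k (x k)) sums t"
    using t unfolding has_nuclear_trace_def blinfun.zero_left by blast
  obtain r where r: "r \<longlonglongrightarrow> 0" "\<And>k. r k \<ge> 0"
    "\<And>k. r k = 0 \<Longrightarrow> norm (f k) * norm (x k) = 0"
    "summable (\<lambda>k. norm (f k) * norm (x k) / r k)"
    using summable_div_sqrt_tail[OF f(2)] by auto
  define z where "z k = (r k / norm (x k)) *\<^sub>R x k" for k
  define g where "g k = (norm (x k) / r k) *\<^sub>R f k" for k
  \<comment> \<open>If \<open>x k = 0\<close> or \<open>r k = 0\<close>, then \<open>f k \<otimes> x k = 0\<close> and \<open>g k \<otimes> z k = 0\<close>, as division by \<open>0\<close> gives \<open>0\<close>.\<close>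
  have gz: "smul (g k y) (z k) = smul (f k y) (x k)" for k y
  proof (cases "x k = 0 \<or> r k = 0")
    case True
    then show ?thesis using r(3)[of k]
      by (auto simp: g_def z_def blinfun.scaleR_left smul.scaleR_left smul.scaleR_right)
  next
    case False
    then show ?thesis
      by (simp add: g_def z_def blinfun.scaleR_left smul.scaleR_left smul.scaleR_right)
  qed
  have gz': "g k (z k) = f k (x k)" for k
  proof (cases "x k = 0 \<or> r k = 0")
    case True
    then show ?thesis using r(3)[of k]
      by (auto simp: g_def z_def blinfun.scaleR_left blinfun.scaleR_right)
  next
    case False
    then show ?thesis
      by (simp add: g_def z_def blinfun.scaleR_left blinfun.scaleR_right)
  qed
  have g: "g k \<in> dual_space smul" for k
    using f(1) by (simp add: g_def dual_space_def blinfun.scaleR_left)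
  have sg: "summable (\<lambda>k. norm (g k))"
    using r(2,4) by (simp add: g_def mult.commute)
  have "z \<longlonglongrightarrow> 0"
    by (rule Lim_null_comparison[OF _ r(1)]) (use r(2) in \<open>auto simp: z_def\<close>)
  then have K: "compact (insert 0 (range z))" by (rule compact_range_convergent)
  have bound: "norm t \<le> e * (\<Sum>k. norm (g k))" if "e > 0" for e
  proof -
    obtain T where T: "T \<in> bounded_ops smul" "finite_dim smul (range (blinfun_apply T))"
      "\<And>y. y \<in> insert 0 (range z) \<Longrightarrow> norm (T y - y) \<le> e"
      using AP[unfolded approximation_property_def, rule_format, OF conjI[OF K \<open>e > 0\<close>]] by blast
    obtain B where B: "finite B" "independent B" "range (blinfun_apply T) \<subseteq> span B"
      using finite_dim_basis[OF T(2) empty_subsetI independent_empty] by metis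
    obtain h where h: "\<And>b. b \<in> B \<Longrightarrow> h b \<in> dual_space smul"
      "\<And>y. T y = (\<Sum>b\<in>B. smul (h b y) b)"
      using finite_rank_coords[OF T(1) B] by metis
    have "(\<lambda>k. \<Sum>b\<in>B. g k b * h b (z k)) sums (\<Sum>b\<in>B. 0)"
    proof (rule sums_sum)
      fix b assume "b \<in> B"
      have "(\<lambda>k. h b (smul (g k b) (z k))) sums h b 0"
        using f(3)[of b] by (intro bounded_linear.sums[OF blinfun.bounded_linear_right]) (simp add: gz)
      then show "(\<lambda>k. g k b * h b (z k)) sums 0"
        by (simp add: dual_spaceD[OF h(1)[OF \<open>b \<in> B\<close>]])
    qed
    moreover have "(\<Sum>b\<in>B. g k b * h b (z k)) = g k (T (z k))" for k
      by (simp add: h(2) blinfun.sum_right dual_spaceD[OF g] mult.commute)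
    ultimately have "(\<lambda>k. g k (T (z k))) sums 0" by simp
    moreover have "(\<lambda>k. g k (z k)) sums t" using f(4) by (simp add: gz')
    ultimately have "(\<lambda>k. g k (T (z k)) - g k (z k)) sums (0 - t)" by (rule sums_diff)
    moreover have "(\<lambda>k. e * norm (g k)) sums (e * (\<Sum>k. norm (g k)))"
      using sg by (intro sums_mult summable_sums)
    moreover have "norm (g k (T (z k)) - g k (z k)) \<le> e * norm (g k)" for k
    proof -
      have "norm (g k (T (z k)) - g k (z k)) \<le> norm (g k) * norm (T (z k) - z k)"
        using norm_blinfun[of "g k" "T (z k) - z k"] by (simp add: blinfun.diff_right)
      also have "\<dots> \<le> norm (g k) * e" by (intro mult_left_mono T(3)) auto
      finally show ?thesis by (simp add: mult.commute)
    qed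
    ultimately have "norm (0 - t) \<le> e * (\<Sum>k. norm (g k))" by (rule norm_sums_le)
    then show ?thesis by simp
  qed
  define M where "M = (\<Sum>k. norm (g k))"
  have M: "M \<ge> 0" unfolding M_def using sg by (intro suminf_nonneg) auto
  have "norm t \<le> 0 + e" if "e > 0" for e
  proof -
    have "norm t \<le> e / (M + 1) * M" using bound[of "e / (M + 1)"] M that by (simp add: M_def)
    also have "\<dots> \<le> e" using M that by (simp add: field_simps)
    finally show ?thesis by simp
  qed
  then have "norm t \<le> 0" by (rule field_le_epsilon)
  then show ?thesis by simp
qed

lemma has_nuclear_trace_unique:
  assumes "approximation_property smul" "has_nuclear_trace T s" "has_nuclear_trace T t"
  shows "s = t"
  using has_nuclear_trace_zero_unique[OF assms(1), of "s - t"]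
    has_nuclear_trace_diff[OF assms(2,3)] by simp

lemma rank_one_obtain_tensor:
  assumes "rank_one smul A"
  obtains f x where "f \<in> dual_space smul" "A = tensor f x" "norm A = norm f * norm x"
    "rank_one_trace smul A = f x"
proof -
  have A: "A \<in> bounded_ops smul" and dim: "dim (range (blinfun_apply A)) = 1"
    using assms by (auto simp: rank_one_def)
  obtain B where B: "B \<subseteq> range (blinfun_apply A)" "independent B"
    "range (blinfun_apply A) \<subseteq> span B" "card B = 1"
    using basis_exists[of "range (blinfun_apply A)"] dim by metis
  obtain x where x: "B = {x}" using B(4) by (auto simp: card_1_singleton_iff)
  have x0: "x \<noteq> 0" using B(2) x dependent_zero by auto
  have fB: "finite B" using x by simp
  obtain g where "\<And>b. b \<in> B \<Longrightarrow> g b \<in> dual_space smul" "\<And>y. A y = (\<Sum>b\<in>B. smul (g b y) b)"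
    using finite_rank_coords[OF A fB B(2,3)] by metis
  then have "g x \<in> dual_space smul" "\<And>y. A y = smul (g x y) x" by (simp_all add: x)
  then obtain f where f: "f \<in> dual_space smul" "\<And>y. A y = smul (f y) x" by blast
  have At: "A = tensor f x" by (rule blinfun_eqI) (simp add: f(2))
  have "norm A = norm f * norm x"
  proof (rule antisym)
    show "norm A \<le> norm f * norm x"
      using norm_tensor[of f x] At by simp
    have "norm f \<le> norm A / norm x"
    proof (rule norm_blinfun_bound)
      fix y
      have "norm (f y) * norm x \<le> norm A * norm y"
        using norm_blinfun[of A y] by (simp add: f(2) norm_scale)
      then show "norm (f y) \<le> norm A / norm x * norm y" using x0 by (simp add: field_simps)
    qed simp
    then show "norm f * norm x \<le> norm A" using x0 by (simp add: field_simps)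
  qed
  moreover have "rank_one_trace smul A = f x"
    unfolding rank_one_trace_def
  proof (rule the_equality)
    show "\<exists>f'\<in>dual_space smul. \<exists>x'. (\<forall>y. A y = smul (f' y) x') \<and> f x = f' x'"
      using f by blast
    fix t assume "\<exists>f'\<in>dual_space smul. \<exists>x'. (\<forall>y. A y = smul (f' y) x') \<and> t = f' x'"
    then obtain f' x' where f': "f' \<in> dual_space smul" "\<And>y. A y = smul (f' y) x'" "t = f' x'"
      by blast
    obtain u where "x = A u" using B(1) x by auto
    then have x': "x = smul (f' u) x'" and fu: "f' u \<noteq> 0" using f'(2)[of u] x0 by auto
    \<comment> \<open>Evaluate \<open>A x'\<close> in both representations.\<close>
    have "smul (f x') x = smul (f' x') x'" using f(2) f'(2) by metis
    then have "smul (f x' * f' u) x' = smul (f' x') x'" using x' by (metis scale_scale)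
    moreover have "x' \<noteq> 0" using x' x0 by auto
    ultimately have "f x' * f' u = f' x'" by (simp only: scale_cancel_right) simp
    moreover have "f x = f' u * f x'" using x' dual_spaceD[OF f(1)] by metis
    ultimately show "t = f x" using f'(3) by (simp add: mult.commute)
  qed
  ultimately show ?thesis using that f(1) At by blast
qed

lemma nuclear_representation_has_trace:
  assumes "nuclear_representation smul A T"
  obtains t where "(\<lambda>k. rank_one_trace smul (A k)) sums t"
    "has_nuclear_trace T t"
proof -
  have A: "\<And>k. rank_one smul (A k)" "summable (\<lambda>k. norm (A k))" "A sums T"
    using assms by (auto simp: nuclear_representation_def)
  have "\<exists>f x. f \<in> dual_space smul \<and> A k = tensor f x \<and> norm (A k) = norm f * norm x \<and>
    rank_one_trace smul (A k) = f x" for k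
    using rank_one_obtain_tensor[OF A(1)[of k]] by metis
  then obtain f x where f: "\<And>k. f k \<in> dual_space smul" "\<And>k. A k = tensor (f k) (x k)"
    "\<And>k. norm (A k) = norm (f k) * norm (x k)" "\<And>k. rank_one_trace smul (A k) = f k (x k)"
    by metis
  have "summable (\<lambda>k. f k (x k))"
    by (rule summable_comparison_test'[OF A(2)]) (simp add: f(3) norm_blinfun)
  then obtain t where t: "(\<lambda>k. f k (x k)) sums t" by (auto simp: summable_def)
  have "has_nuclear_trace T t"
  proof (rule has_nuclear_traceI[of f x])
    show "(\<lambda>k. smul (f k y) (x k)) sums T y" for y
      using bounded_linear.sums[OF blinfun.bounded_linear_left A(3), of y] by (simp add: f(2))
  qed (use f A(2) t in auto)
  then show ?thesis using that t by (simp add: f(4))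
qed

lemma nuclear_has_trace:
  assumes "approximation_property smul" "nuclear smul T"
  shows "has_nuclear_trace T (nuclear_trace smul T)"
proof -
  obtain A where A: "nuclear_representation smul A T" using assms(2) by (auto simp: nuclear_def)
  obtain t where t: "(\<lambda>k. rank_one_trace smul (A k)) sums t" "has_nuclear_trace T t"
    using A by (rule nuclear_representation_has_trace)
  have "nuclear_trace smul T = t"
    unfolding nuclear_trace_def
  proof (rule the_equality)
    show "\<exists>A. nuclear_representation smul A T \<and> (\<lambda>k. rank_one_trace smul (A k)) sums t"
      using A t(1) by blast
    fix s assume "\<exists>A. nuclear_representation smul A T \<and> (\<lambda>k. rank_one_trace smul (A k)) sums s"
    then obtain A' where "nuclear_representation smul A' T" "(\<lambda>k. rank_one_trace smul (A' k)) sums s"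
      by blast
    then have "has_nuclear_trace T s"
      by (metis nuclear_representation_has_trace sums_unique2)
    then show "s = t" using has_nuclear_trace_unique[OF assms(1)] t(2) by blast
  qed
  then show ?thesis using t(2) by simp
qed

text \<open>
  For nuclear \<open>K\<close> the operator \<open>1 - K\<close> is invertible up to finite rank: if \<open>F\<close> is a long partial
  sum of a representation of \<open>K\<close>, then \<open>1 - (K - F)\<close> has an inverse \<open>Z\<close>.
\<close>

lemma has_nuclear_trace_parametrix:
  assumes K: "has_nuclear_trace K t" "K \<in> bounded_ops smul"
  obtains F Z where "F \<in> bounded_ops smul" "Z \<in> bounded_ops smul"
    "finite_dim smul (range (blinfun_apply F))"
    "\<And>y. Z (y - K y) = y - Z (F y)" "\<And>y. Z y - K (Z y) = y - F (Z y)"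
proof -
  obtain f x where f: "\<And>k. f k \<in> dual_space smul" "summable (\<lambda>k. norm (f k) * norm (x k))"
    "\<And>y. (\<lambda>k. smul (f k y) (x k)) sums K y"
    using K(1) unfolding has_nuclear_trace_def by blast
  let ?a = "\<lambda>k. norm (f k) * norm (x k)"
  have "(\<lambda>N. \<Sum>k. ?a (k + N)) \<longlonglongrightarrow> 0" by (rule suminf_exist_split2[OF f(2)])
  from LIMSEQ_D[OF this zero_less_one] obtain N where N: "norm (\<Sum>k. ?a (k + N)) < 1"
    by auto
  define F where "F = (\<Sum>k<N. tensor (f k) (x k))"
  have F: "F y = (\<Sum>k<N. smul (f k y) (x k))" for y by (simp add: F_def blinfun.sum_left)
  have Fb: "F \<in> bounded_ops smul" unfolding F_def using f(1) by blast
  have "range (blinfun_apply F) \<subseteq> span (x ` {..<N})"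
  proof (rule image_subsetI)
    show "F y \<in> span (x ` {..<N})" for y
      unfolding F by (intro span_sum span_scale span_base) auto
  qed
  then have fin: "finite_dim smul (range (blinfun_apply F))"
    unfolding finite_dim_def by (metis finite_imageI finite_lessThan)
  have sa: "summable (\<lambda>k. ?a (k + N))" using f(2) summable_ignore_initial_segment by fast
  have "norm (K - F) \<le> (\<Sum>k. ?a (k + N))"
  proof (rule norm_blinfun_bound)
    show "0 \<le> (\<Sum>k. ?a (k + N))" using sa by (intro suminf_nonneg) auto
    fix y
    have "(\<lambda>k. smul (f (k + N) y) (x (k + N))) sums (K - F) y"
      using sums_split_initial_segment[OF f(3)[of y], of N] by (simp add: F blinfun.diff_left)
    moreover have "(\<lambda>k. ?a (k + N) * norm y) sums ((\<Sum>k. ?a (k + N)) * norm y)"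
      by (intro sums_mult2 summable_sums sa)
    moreover have "norm (smul (f (k + N) y) (x (k + N))) \<le> ?a (k + N) * norm y" for k
      using mult_right_mono[OF norm_blinfun[of "f (k + N)" y], of "norm (x (k + N))"]
      by (simp add: norm_scale algebra_simps)
    ultimately show "norm ((K - F) y) \<le> (\<Sum>k. ?a (k + N)) * norm y" by (rule norm_sums_le)
  qed
  then have "norm (K - F) < 1" using N by simp
  then obtain Z where Z: "Z \<in> bounded_ops smul" "\<And>x. Z x - (K - F) (Z x) = x"
    "\<And>x. Z (x - (K - F) x) = x"
    using neumann_inverse[of "K - F"] Fb K(2) by blast
  show ?thesis
  proof (rule that[OF Fb Z(1) fin])
    fix y
    show "Z (y - K y) = y - Z (F y)"
      using Z(3)[of y] by (simp add: blinfun.bilinear_simps algebra_simps)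
    show "Z y - K (Z y) = y - F (Z y)"
      using Z(2)[of y] by (simp add: blinfun.bilinear_simps algebra_simps)
  qed
qed

end

section \<open>Generalized inverses and projections of finite rank\<close>

context banach_over
begin

text \<open>
  Atkinson's argument: if \<open>r\<close> is a generalized inverse of \<open>U\<close> up to finite rank, then \<open>U\<close> has a
  bounded generalized inverse. The defect \<open>M = U - UrU = \<psi>U\<close> has finite rank, and a linear right
  inverse of \<open>M\<close> on its range extends, by \<open>0\<close> on further basis vectors, to the range of \<open>\<psi>\<close>.
  Composed with \<open>\<psi>\<close> it gives a bounded operator \<open>H\<close> with \<open>MHU = M\<close>, and then \<open>r + (1 - rU)H\<close> is
  a generalized inverse of \<open>U\<close>.
\<close>

lemma generalized_inverse_exists:
  assumes b: "U \<in> bounded_ops smul" "r \<in> bounded_ops smul" "\<psi> \<in> bounded_ops smul"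
    and fin: "finite_dim smul (range (blinfun_apply \<psi>))"
    and defect: "\<And>y. U (r (U y)) = U y - \<psi> (U y)"
  obtains S where "S \<in> bounded_ops smul" "\<And>y. U (S (U y)) = U y"
proof -
  define M where "M = \<psi> o\<^sub>L U"
  have M: "M y = \<psi> (U y)" for y by (simp add: M_def)
  have Mb: "M \<in> bounded_ops smul" using b by (auto simp: M_def)
  have MR: "range (blinfun_apply M) \<subseteq> range (blinfun_apply \<psi>)" by (auto simp: M)
  obtain B1 where B1: "B1 \<subseteq> range (blinfun_apply M)" "finite B1" "independent B1"
    "range (blinfun_apply M) \<subseteq> span B1"
    using finite_dim_basis[OF finite_dim_subset[OF fin MR] empty_subsetI independent_empty] by metis
  obtain B2 where B2: "B1 \<subseteq> B2" "finite B2" "independent B2" "range (blinfun_apply \<psi>) \<subseteq> span B2"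
    using finite_dim_basis[OF fin order_trans[OF B1(1) MR] B1(3)] by metis
  obtain g where g: "\<And>b. b \<in> B2 \<Longrightarrow> g b \<in> dual_space smul"
    "\<And>b y. b \<in> B2 \<Longrightarrow> g b y = representation B2 (\<psi> y) b"
    using finite_rank_coords[OF b(3) B2(2-4)] by metis
  have "\<exists>z. M z = b" if "b \<in> B1" for b using B1(1) that by blast
  then obtain h where h: "\<And>b. b \<in> B1 \<Longrightarrow> M (h b) = b" by metis
  define H where "H = (\<Sum>b\<in>B1. tensor (g b) (h b))"
  have Hb: "H \<in> bounded_ops smul" unfolding H_def using g(1) B2(1) by blast
  have MH: "M (H (U y)) = M y" for y
  proof -
    have "M (H (U y)) = (\<Sum>b\<in>B1. smul (g b (U y)) b)"
      by (simp add: H_def blinfun.sum_left blinfun.sum_right bounded_opsD[OF Mb] h)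
    also have "\<dots> = (\<Sum>b\<in>B1. smul (representation B1 (M y) b) b)"
    proof (rule sum.cong[OF refl])
      fix b assume "b \<in> B1"
      have "M y \<in> span B1" using B1(4) by blast
      then show "smul (g b (U y)) b = smul (representation B1 (M y) b) b"
        using g(2)[of b "U y"] \<open>b \<in> B1\<close> B2(1) representation_extend[OF B2(3) _ B2(1), of "M y"]
        by (auto simp: M)
    qed
    also have "\<dots> = M y"
      using B1(4) by (intro sum_representation_eq[OF B1(3) _ B1(2) order_refl]) blast
    finally show ?thesis .
  qed
  show ?thesis
  proof (rule that[of "r + (H - (r o\<^sub>L U o\<^sub>L H))"])
    show "r + (H - (r o\<^sub>L U o\<^sub>L H)) \<in> bounded_ops smul" using b Hb by auto
    show "U ((r + (H - (r o\<^sub>L U o\<^sub>L H))) (U y)) = U y" for y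
      using MH[of y] by (simp add: blinfun.bilinear_simps defect M)
  qed
qed

text \<open>
  A finite rank projection \<open>L = \<Sum> g\<^sub>b \<otimes> b\<close>, with \<open>b\<close> running over a basis of the range and dual
  functionals \<open>g\<^sub>b\<close>, has trace \<open>\<Sum> g\<^sub>b(b)\<close>, the dimension of its range, and the \<open>g\<^sub>b\<close> form a basis of
  the functionals fixed by the adjoint of \<open>L\<close>.
\<close>

lemma finite_rank_projection:
  assumes L: "L \<in> bounded_ops smul" and idem: "\<And>y. L (L y) = L y"
    and fin: "finite_dim smul (range (blinfun_apply L))"
  defines "V \<equiv> {f \<in> dual_space smul. \<forall>y. f (L y) = f y}"
  shows "has_nuclear_trace L (of_nat (dim (range (blinfun_apply L))))"
    and "finite_dim dual_scale V"
    and "vector_space.dim dual_scale V = dim (range (blinfun_apply L))"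
proof -
  obtain B where B: "{} \<subseteq> B" "B \<subseteq> range (blinfun_apply L)" "finite B" "independent B"
    "range (blinfun_apply L) \<subseteq> span B" "card B = dim (range (blinfun_apply L))"
    by (rule finite_dim_basis[OF fin empty_subsetI independent_empty])
  note B = B(2-)
  interpret D: vector_space "dual_scale :: 'k \<Rightarrow> ('a \<Rightarrow>\<^sub>L 'k) \<Rightarrow> _" by (rule vector_space_dual_scale)
  obtain g where g: "\<And>b. b \<in> B \<Longrightarrow> g b \<in> dual_space smul"
    "\<And>b y. b \<in> B \<Longrightarrow> g b y = representation B (L y) b"
    "\<And>y. L y = (\<Sum>b\<in>B. smul (g b y) b)"
    using finite_rank_coords[OF L B(2-4)] by blast
  have Lb: "L b = b" if "b \<in> B" for b using B(1) idem that by auto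
  have delta: "g b c = (if b = c then 1 else 0)" if "b \<in> B" "c \<in> B" for b c
    using that by (simp add: g(2) Lb representation_basis[OF B(3)])
  have "L = (\<Sum>b\<in>B. tensor (g b) b)"
    by (rule blinfun_eqI) (simp add: g(3)[symmetric] blinfun.sum_left)
  moreover have "has_nuclear_trace (\<Sum>b\<in>B. tensor (g b) b) (\<Sum>b\<in>B. g b b)"
    by (intro has_nuclear_trace_sum has_nuclear_trace_tensor g(1))
  moreover have "(\<Sum>b\<in>B. g b b) = of_nat (card B)" using delta by simp
  ultimately show "has_nuclear_trace L (of_nat (dim (range (blinfun_apply L))))"
    by (simp add: B(5))
  have inj: "inj_on g B" using delta by (metis inj_onI zero_neq_one)
  have GV: "g ` B \<subseteq> V" using g(1,2) idem by (auto simp: V_def)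
  have VG: "V \<subseteq> D.span (g ` B)"
  proof
    fix f assume f: "f \<in> V"
    have "f = (\<Sum>b\<in>B. dual_scale (f b) (g b))"
    proof (rule blinfun_eqI)
      fix y
      have "f y = f (\<Sum>b\<in>B. smul (g b y) b)" using f by (simp add: V_def g(3)[symmetric])
      then show "f y = (\<Sum>b\<in>B. dual_scale (f b) (g b)) y"
        using f by (simp add: V_def blinfun.sum_right blinfun.sum_left dual_spaceD mult.commute)
    qed
    also have "\<dots> \<in> D.span (g ` B)" by (intro D.span_sum D.span_scale D.span_base) auto
    finally show "f \<in> D.span (g ` B)" .
  qed
  have ind: "D.independent (g ` B)"
  proof
    assume "D.dependent (g ` B)"
    then obtain u where u: "\<exists>f\<in>g ` B. u f \<noteq> 0" "(\<Sum>f\<in>g ` B. dual_scale (u f) f) = 0"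
      using D.dependent_finite[of "g ` B"] B(2) by auto
    have "u (g c) = 0" if "c \<in> B" for c
    proof -
      have "0 = (\<Sum>b\<in>B. dual_scale (u (g b)) (g b)) c"
        using u(2) by (simp add: sum.reindex[OF inj])
      also have "\<dots> = (\<Sum>b\<in>B. if b = c then u (g c) else 0)"
        unfolding blinfun.sum_left using that by (intro sum.cong) (auto simp: delta)
      also have "\<dots> = u (g c)" using that B(2) by simp
      finally show ?thesis by simp
    qed
    then show False using u(1) by blast
  qed
  show "finite_dim dual_scale V" unfolding finite_dim_def using VG B(2) by blast
  show "vector_space.dim dual_scale V = dim (range (blinfun_apply L))"
    using D.dim_unique[OF GV VG ind] by (simp add: card_image[OF inj] B(5))
qed

end

section \<open>Differences of projections\<close>

context banach_over
begin

lemma projectionD: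
  assumes "projection smul P"
  shows "P \<in> bounded_ops smul" "P (P x) = P x"
proof -
  show "P \<in> bounded_ops smul" using assms by (simp add: projection_def)
  have "(P o\<^sub>L P) x = P x" using assms by (simp add: projection_def)
  then show "P (P x) = P x" by simp
qed

text \<open>The witness \<open>C\<close> is the sum of the powers \<open>A\<^sup>2\<^sup>j\<close> for \<open>j < m\<close>; each of them commutes with \<open>P\<close> and \<open>Q\<close>.\<close>

lemma geometric_sum_even_powers:
  assumes P: "projection smul P" and Q: "projection smul Q"
  defines "A \<equiv> P - Q"
  obtains C where "C \<in> bounded_ops smul"
    "\<And>x. C x - A (A (C x)) = x - op_power A (2 * m) x"
    "\<And>x. C (P x) = P (C x)" "\<And>x. C (Q x) = Q (C x)"
proof -
  have comm: "op_power A (2 * m) (P x) = P (op_power A (2 * m) x)"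
    "op_power A (2 * m) (Q x) = Q (op_power A (2 * m) x)" for m x
    by (induction m)
      (simp_all add: A_def blinfun.diff_left blinfun.diff_right projectionD(2)[OF P] projectionD(2)[OF Q])
  have Ab: "A \<in> bounded_ops smul"
    unfolding A_def using projectionD(1)[OF P] projectionD(1)[OF Q] by blast
  have "\<exists>C\<in>bounded_ops smul. (\<forall>x. C x - A (A (C x)) = x - op_power A (2 * m) x) \<and>
    (\<forall>x. C (P x) = P (C x)) \<and> (\<forall>x. C (Q x) = Q (C x))"
  proof (induction m)
    case 0
    show ?case by (rule bexI[of _ 0]) auto
  next
    case (Suc m)
    then obtain C where C: "C \<in> bounded_ops smul"
      "\<And>x. C x - A (A (C x)) = x - op_power A (2 * m) x"
      "\<And>x. C (P x) = P (C x)" "\<And>x. C (Q x) = Q (C x)"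
      by blast
    show ?case
    proof (intro bexI[of _ "C + op_power A (2 * m)"] conjI allI)
      show "C + op_power A (2 * m) \<in> bounded_ops smul" using C(1) Ab by blast
      fix x
      show "(C + op_power A (2 * m)) x - A (A ((C + op_power A (2 * m)) x))
          = x - op_power A (2 * Suc m) x"
      proof -
        have "c + p - (a + b) = x - b" if "c - a = x - p" for a b c p :: 'a
          using that by (simp add: algebra_simps)
        from this[OF C(2)[of x]] show ?thesis by (simp add: blinfun.add_left blinfun.add_right)
      qed
    qed (simp_all add: C comm blinfun.bilinear_simps)
  qed
  then show ?thesis using that by blast
qed

lemma op_power_anticomm:
  fixes T S :: "'a \<Rightarrow>\<^sub>L 'a"
  assumes anti: "\<And>x. S (T x) = - T (S x)" and "odd n"
  shows "S (op_power T n x) = - op_power T n (S x)"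
proof -
  have "S (op_power T n x) = (if even n then op_power T n (S x) else - op_power T n (S x))" for n
    by (induction n) (simp_all add: anti blinfun.minus_right)
  then show ?thesis using \<open>odd n\<close> by simp
qed

text \<open>
  The trace formula. Notation: \<open>A = P - Q\<close>, \<open>W = 1 - P - Q\<close>, \<open>U = QP\<close>, \<open>K = A\<^sup>n\<^sup>+\<^sup>1\<close>.
\<close>

lemma trace_odd_power_difference:
  assumes AP: "approximation_property smul" and n: "odd n"
    and P: "projection smul P" and Q: "projection smul Q"
    and \<tau>: "has_nuclear_trace (op_power (P - Q) n) \<tau>"
  shows "finite_dim smul (joint_eigenspace smul P Q 1 0)"
    and "finite_dim dual_scale (dual_joint_eigenspace smul P Q 0 1)"
    and "\<tau> = of_nat (dim (joint_eigenspace smul P Q 1 0)) -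
      of_nat (vector_space.dim dual_scale (dual_joint_eigenspace smul P Q 0 1))"
proof -
  note unique = has_nuclear_trace_unique[OF AP]
  define A where "A = P - Q"
  define An where "An = op_power A n"
  define K where "K = A o\<^sub>L An"
  define U where "U = Q o\<^sub>L P"
  have Pb: "P \<in> bounded_ops smul" and Qb: "Q \<in> bounded_ops smul"
    and PP: "P (P x) = P x" and QQ: "Q (Q x) = Q x" for x
    using projectionD[OF P] projectionD[OF Q] by auto
  have Ab: "A \<in> bounded_ops smul" and Anb: "An \<in> bounded_ops smul"
    and Kb: "K \<in> bounded_ops smul" and Ub: "U \<in> bounded_ops smul"
    using Pb Qb by (auto simp: A_def An_def K_def U_def)
  have A: "A x = P x - Q x" and U: "U x = Q (P x)" for x
    by (simp_all add: A_def U_def blinfun.diff_left)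
  have K: "K x = A (An x)" and K': "K x = An (A x)" for x
    by (simp_all add: K_def An_def op_power_comm)
  have KSuc: "K = op_power A (Suc n)" by (simp add: K_def An_def)
  have \<tau>: "has_nuclear_trace An \<tau>" using \<tau> by (simp add: An_def A_def)

  \<comment> \<open>The parametrix \<open>S = PCQ\<close> of \<open>U\<close>.\<close>
  obtain m where m: "Suc n = 2 * m" using n by (metis even_Suc evenE)
  obtain C where C: "C \<in> bounded_ops smul" "\<And>x. C x - A (A (C x)) = x - op_power A (2 * m) x"
    "\<And>x. C (P x) = P (C x)" "\<And>x. C (Q x) = Q (C x)"
    using geometric_sum_even_powers[OF P Q, of m] unfolding A_def by blast
  have CK: "C x - A (A (C x)) = x - K x" for x using C(2)[of x] by (simp add: KSuc m)
  have PQP: "P (Q (P x)) = P (x - A (A x))" and QPQ: "Q (P (Q x)) = Q (x - A (A x))" for x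
    by (simp_all add: A blinfun.diff_right PP QQ)
  define S where "S = P o\<^sub>L C o\<^sub>L Q"
  have Sb: "S \<in> bounded_ops smul" using Pb Qb C(1) by (auto simp: S_def)
  have S: "S x = P (C (Q x))" for x by (simp add: S_def)
  have SU: "S (U x) = P x - P (K x)" for x
  proof -
    have "S (U x) = P (Q (P (C x)))" by (simp add: S U QQ C(3,4))
    then show ?thesis by (simp add: PQP CK blinfun.diff_right)
  qed
  have US: "U (S x) = Q x - Q (K x)" for x
  proof -
    have "U (S x) = Q (P (Q (C x)))" by (simp add: S U PP C(3,4))
    then show ?thesis by (simp add: QPQ CK blinfun.diff_right)
  qed

  \<comment> \<open>\<open>SZ\<close> inverts \<open>U\<close> up to finite rank, hence \<open>U\<close> has a generalized inverse \<open>S1\<close>.\<close>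
  obtain \<kappa> where \<kappa>: "has_nuclear_trace K \<kappa>"
    using has_nuclear_trace_cyclic[OF \<tau> Ab] unfolding K_def by blast
  obtain F Z where FZ: "F \<in> bounded_ops smul" "Z \<in> bounded_ops smul"
    "finite_dim smul (range (blinfun_apply F))"
    "\<And>y. Z (y - K y) = y - Z (F y)" "\<And>y. Z y - K (Z y) = y - F (Z y)"
    using has_nuclear_trace_parametrix[OF \<kappa> Kb] by blast
  have USZ: "U (S (Z x)) = Q x - Q (F (Z x))" for x
  proof -
    have "U (S (Z x)) = Q (Z x - K (Z x))" by (simp add: US blinfun.diff_right)
    then show ?thesis by (simp add: FZ(5) blinfun.diff_right)
  qed
  have fin: "finite_dim smul (range (blinfun_apply (Q o\<^sub>L F o\<^sub>L Z)))"
    using FZ(3) Qb by (rule finite_dim_range_compose)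
  have b1: "S o\<^sub>L Z \<in> bounded_ops smul" "Q o\<^sub>L F o\<^sub>L Z \<in> bounded_ops smul"
    using Sb FZ(1,2) Qb by auto
  have "U ((S o\<^sub>L Z) (U y)) = U y - (Q o\<^sub>L F o\<^sub>L Z) (U y)" for y
    by (simp add: USZ) (simp add: U QQ)
  then obtain R where R: "R \<in> bounded_ops smul" "\<And>y. U (R (U y)) = U y"
    using generalized_inverse_exists[OF Ub b1 fin] by blast
  define S1 where "S1 = P o\<^sub>L R o\<^sub>L Q"
  have S1b: "S1 \<in> bounded_ops smul" using Pb Qb R(1) by (auto simp: S1_def)
  have S1: "S1 x = P (R (Q x))" for x by (simp add: S1_def)
  have UP: "U (P x) = U x" and QU: "Q (U x) = U x" for x by (simp_all add: U PP QQ)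
  have PS1: "P (S1 x) = S1 x" and S1Q: "S1 (Q x) = S1 x" for x by (simp_all add: S1 PP QQ)
  have US1U: "U (S1 (U x)) = U x" for x by (simp add: S1 UP QU R(2))

  \<comment> \<open>\<open>J\<close> is a projection onto \<open>E\<^sub>1\<^sub>0\<close>.\<close>
  define J where "J = P - (S1 o\<^sub>L U)"
  define E where "E = joint_eigenspace smul P Q 1 0"
  have Jb: "J \<in> bounded_ops smul" using Pb S1b Ub by (auto simp: J_def)
  have J: "J x = P x - S1 (U x)" for x by (simp add: J_def blinfun.diff_left)
  have JJ: "J (J x) = J x" for x
    by (simp add: J blinfun.diff_right PP PS1 UP US1U)
  have E: "x \<in> E \<longleftrightarrow> P x = x \<and> Q x = 0" for x by (simp add: E_def joint_eigenspace_def)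
  have rJ: "range (blinfun_apply J) = E"
  proof
    have PJ: "P (J x) = J x" for x by (simp add: J blinfun.diff_right PP PS1)
    have "U (J x) = 0" for x by (simp add: J blinfun.diff_right UP US1U)
    then have "Q (J x) = 0" for x using U[of "J x"] by (simp add: PJ)
    with PJ show "range (blinfun_apply J) \<subseteq> E" by (auto simp: E)
    have "J x = x" if "x \<in> E" for x using that by (simp add: E J U)
    then show "E \<subseteq> range (blinfun_apply J)" by (metis rangeI subsetI)
  qed
  have finE: "finite_dim smul E"
  proof (rule finite_dim_subset[OF finite_dim_range_compose[OF FZ(3,2), of id_blinfun]])
    have "x = Z (F x)" if "x \<in> E" for x
    proof -
      have "A x = x" using that by (simp add: E A)
      then have "op_power A k x = x" for k by (induction k) auto
      then have "K x = x" by (simp only: KSuc)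
      then show ?thesis using FZ(4)[of x] by (simp add: blinfun.zero_right)
    qed
    then show "E \<subseteq> range (blinfun_apply (Z o\<^sub>L F o\<^sub>L id_blinfun))" by (auto intro: range_eqI)
  qed
  then show "finite_dim smul (joint_eigenspace smul P Q 1 0)" by (simp add: E_def)
  have trJ: "has_nuclear_trace J (of_nat (dim E))"
    using finite_rank_projection(1)[OF Jb JJ] finE rJ by simp

  \<comment> \<open>The adjoint of \<open>L\<close> is a projection onto \<open>E\<^sub>0\<^sub>1\<close> of the dual.\<close>
  define L where "L = Q - (U o\<^sub>L S1)"
  define E' where "E' = dual_joint_eigenspace smul P Q 0 1"
  have Lb: "L \<in> bounded_ops smul" using Qb S1b Ub by (auto simp: L_def)
  have L: "L x = Q x - U (S1 x)" for x by (simp add: L_def blinfun.diff_left)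
  have LU: "L (U x) = 0" for x by (simp add: L QU US1U)
  have LQ: "L (Q x) = L x" for x by (simp add: L QQ S1Q)
  have LP: "L (P x) = 0" for x using LU[of x] LQ[of "P x"] by (simp add: U)
  have LL: "L (L x) = L x" for x
    using LU[of "S1 x"] LQ[of x] by (simp add: L[of x] blinfun.diff_right)
  have LK: "L (K x) = L x" for x
    using LU[of "S x"] by (simp add: US blinfun.diff_right LQ)
  have finL: "finite_dim smul (range (blinfun_apply L))"
  proof (rule finite_dim_subset[OF finite_dim_range_compose[OF FZ(3) Lb, of Z]])
    have "L x = L (F (Z x))" for x
    proof -
      have "L (Z x - K (Z x)) = 0" by (simp add: blinfun.diff_right LK)
      then show ?thesis by (simp add: FZ(5) blinfun.diff_right)
    qed
    then show "range (blinfun_apply L) \<subseteq> range (blinfun_apply (L o\<^sub>L F o\<^sub>L Z))"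
      by (auto intro: range_eqI)
  qed
  have E': "E' = {f \<in> dual_space smul. \<forall>y. f (L y) = f y}"
  proof -
    have "(adjoint_op P f = dual_scale 0 f \<and> adjoint_op Q f = dual_scale 1 f) \<longleftrightarrow>
        (\<forall>y. f (L y) = f y)" for f :: "'a \<Rightarrow>\<^sub>L 'k"
    proof
      assume f: "adjoint_op P f = dual_scale 0 f \<and> adjoint_op Q f = dual_scale 1 f"
      have fP: "f (P y) = 0" and fQ: "f (Q y) = f y" for y
        using arg_cong[OF conjunct1[OF f], of "\<lambda>g. g y"] arg_cong[OF conjunct2[OF f], of "\<lambda>g. g y"]
        by (simp_all add: adjoint_op_def)
      show "\<forall>y. f (L y) = f y" by (simp add: L U blinfun.diff_right fP fQ)
    next
      assume f: "\<forall>y. f (L y) = f y"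
      have "f (P y) = 0" and "f (Q y) = f y" for y
        using spec[OF f, of "P y"] spec[OF f, of "Q y"] spec[OF f, of y]
        by (simp_all add: LP LQ blinfun.zero_right)
      then show "adjoint_op P f = dual_scale 0 f \<and> adjoint_op Q f = dual_scale 1 f"
        by (auto intro!: blinfun_eqI simp: adjoint_op_def)
    qed
    then show ?thesis by (auto simp: E'_def dual_joint_eigenspace_def)
  qed
  show "finite_dim dual_scale (dual_joint_eigenspace smul P Q 0 1)"
    using finite_rank_projection(2)[OF Lb LL finL] E' by (simp add: E'_def)
  have trL: "has_nuclear_trace L (of_nat (vector_space.dim dual_scale E'))"
    using finite_rank_projection(1,3)[OF Lb LL finL] E' by simp

  \<comment> \<open>\<open>A\<^sup>n - A\<^sup>n\<^sup>+\<^sup>2 = A\<^sup>n W\<^sup>2\<close> has trace \<open>0\<close>, since \<open>W A\<^sup>n = - A\<^sup>n W\<close>.\<close>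
  define W where "W = id_blinfun - P - Q"
  have Wb: "W \<in> bounded_ops smul" using Pb Qb by (auto simp: W_def)
  have W: "W x = x - P x - Q x" for x by (simp add: W_def blinfun.diff_left)
  have "W (A x) = - A (W x)" for x by (simp add: W A blinfun.diff_right PP QQ)
  then have WAn: "W (An x) = - An (W x)" for x unfolding An_def using n by (rule op_power_anticomm)
  obtain s0 where s0: "has_nuclear_trace (An o\<^sub>L W) s0"
    using has_nuclear_trace_cyclic[OF \<tau> Wb] by blast
  obtain s where s: "has_nuclear_trace (An o\<^sub>L W o\<^sub>L W) s" "has_nuclear_trace (W o\<^sub>L (An o\<^sub>L W)) s"
    using has_nuclear_trace_cyclic[OF s0 Wb] by blast
  have "W o\<^sub>L (An o\<^sub>L W) = - (An o\<^sub>L W o\<^sub>L W)"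
    by (rule blinfun_eqI) (simp add: WAn blinfun.minus_left)
  then have "s = - s" using unique[OF s(2)] has_nuclear_trace_minus[OF s(1)] by metis
  then have "2 * s = 0" by (metis add.right_inverse mult_2)
  then have "s = 0" by simp

  \<comment> \<open>\<open>A\<^sup>n\<^sup>+\<^sup>2 = PK - QK\<close>.\<close>
  obtain p where p: "has_nuclear_trace (P o\<^sub>L K) p" using has_nuclear_trace_cyclic[OF \<kappa> Pb] by blast
  obtain q where q: "has_nuclear_trace (Q o\<^sub>L K) q" using has_nuclear_trace_cyclic[OF \<kappa> Qb] by blast
  have AW: "A (A x) + W (W x) = x" for x by (simp add: A W blinfun.diff_right PP QQ)
  have "An - (An o\<^sub>L W o\<^sub>L W) = (P o\<^sub>L K) - (Q o\<^sub>L K)"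
  proof (rule blinfun_eqI)
    fix x
    have "An x = An (A (A x)) + An (W (W x))" by (simp add: blinfun.add_right[symmetric] AW)
    moreover have "An (A (A x)) = A (K x)" by (metis K K')
    ultimately show "(An - (An o\<^sub>L W o\<^sub>L W)) x = ((P o\<^sub>L K) - (Q o\<^sub>L K)) x"
      by (simp add: blinfun.diff_left A)
  qed
  then have \<tau>pq: "\<tau> = p - q"
    using unique[OF has_nuclear_trace_diff[OF \<tau> s(1)]] has_nuclear_trace_diff[OF p q] \<open>s = 0\<close> by simp

  \<comment> \<open>\<open>S1 - S = S1 QK - JS\<close> is nuclear, so \<open>(S1 - S) U\<close> and \<open>U (S1 - S)\<close> have the same trace.\<close>
  obtain d1 where d1: "has_nuclear_trace (S1 o\<^sub>L (Q o\<^sub>L K)) d1"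
    using has_nuclear_trace_cyclic[OF q S1b] by blast
  obtain d2 where d2: "has_nuclear_trace (J o\<^sub>L S) d2"
    using has_nuclear_trace_cyclic[OF trJ Sb] by blast
  have "(S1 o\<^sub>L (Q o\<^sub>L K)) - (J o\<^sub>L S) = S1 - S"
  proof (rule blinfun_eqI)
    fix x
    have "J (S x) = S x - S1 (U (S x))" by (simp add: J S PP)
    also have "S1 (U (S x)) = S1 x - S1 (Q (K x))" by (simp add: US blinfun.diff_right S1Q)
    finally show "((S1 o\<^sub>L (Q o\<^sub>L K)) - (J o\<^sub>L S)) x = (S1 - S) x"
      by (simp add: blinfun.diff_left)
  qed
  then have D: "has_nuclear_trace (S1 - S) (d1 - d2)" using has_nuclear_trace_diff[OF d1 d2] by simp
  obtain d where d: "has_nuclear_trace ((S1 - S) o\<^sub>L U) d" "has_nuclear_trace (U o\<^sub>L (S1 - S)) d"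
    using has_nuclear_trace_cyclic[OF D Ub] by blast
  have "(S1 - S) o\<^sub>L U = (P o\<^sub>L K) - J"
    by (rule blinfun_eqI) (simp add: blinfun.diff_left SU J)
  then have "d = p - of_nat (dim E)" using unique[OF d(1)] has_nuclear_trace_diff[OF p trJ] by simp
  then have pd: "p = d + of_nat (dim E)" by simp
  have "U o\<^sub>L (S1 - S) = (Q o\<^sub>L K) - L"
    by (rule blinfun_eqI) (simp add: blinfun.diff_left blinfun.diff_right US L)
  then have "d = q - of_nat (vector_space.dim dual_scale E')"
    using unique[OF d(2)] has_nuclear_trace_diff[OF q trL] by simp
  then have qd: "q = d + of_nat (vector_space.dim dual_scale E')" by simp
  have "\<tau> = of_nat (dim E) - of_nat (vector_space.dim dual_scale E')"
    unfolding \<tau>pq pd qd by simp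
  then show "\<tau> = of_nat (dim (joint_eigenspace smul P Q 1 0)) -
      of_nat (vector_space.dim dual_scale (dual_joint_eigenspace smul P Q 0 1))"
    by (simp add: E_def E'_def)
qed

end

theorem mainTheorem1:
  fixes smul :: "'k::{real_normed_field,euclidean_space} \<Rightarrow> 'a::banach \<Rightarrow> 'a"
    and P Q :: "'a \<Rightarrow>\<^sub>L 'a" and n :: nat
  assumes "banach_over smul"
    and "approximation_property smul"
    and "n > 0" and "odd n"
    and "projection smul P" and "projection smul Q"
    and "nuclear smul (op_power (P - Q) n)"
  shows "finite_dim smul (joint_eigenspace smul P Q 1 0) \<and>
    finite_dim smul (joint_eigenspace smul P Q 0 1) \<and>
    finite_dim dual_scale (dual_joint_eigenspace smul P Q 1 0) \<and>
    finite_dim dual_scale (dual_joint_eigenspace smul P Q 0 1) \<and>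
    nuclear_trace smul (op_power (P - Q) n) =
      of_nat (vector_space.dim smul (joint_eigenspace smul P Q 1 0)) -
      of_nat (vector_space.dim dual_scale (dual_joint_eigenspace smul P Q 0 1)) \<and>
    nuclear_trace smul (op_power (P - Q) n) =
      of_nat (vector_space.dim dual_scale (dual_joint_eigenspace smul P Q 1 0)) -
      of_nat (vector_space.dim smul (joint_eigenspace smul P Q 0 1))"
proof -
  interpret banach_over smul by fact
  define \<tau> where "\<tau> = nuclear_trace smul (op_power (P - Q) n)"
  have \<tau>: "has_nuclear_trace (op_power (P - Q) n) \<tau>"
    unfolding \<tau>_def using assms(2,7) by (rule nuclear_has_trace)
  note PQ = trace_odd_power_difference[OF assms(2,4,5,6) \<tau>]
  \<comment> \<open>The second formula is the first one with \<open>P\<close> and \<open>Q\<close> exchanged.\<close>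
  have "op_power (Q - P) n x = - op_power (P - Q) n x" if "odd n" for n x
  proof -
    have "op_power (Q - P) n x = (if even n then op_power (P - Q) n x else - op_power (P - Q) n x)"
      for n
      by (induction n) (simp_all add: blinfun.bilinear_simps)
    then show ?thesis using that by simp
  qed
  then have "op_power (Q - P) n = - op_power (P - Q) n"
    using assms(4) by (intro blinfun_eqI) (simp add: blinfun.minus_left)
  then have "has_nuclear_trace (op_power (Q - P) n) (- \<tau>)"
    using has_nuclear_trace_minus[OF \<tau>] by simp
  note QP = trace_odd_power_difference[OF assms(2,4,6,5) this]
  have swap: "joint_eigenspace smul Q P 1 0 = joint_eigenspace smul P Q 0 1"
    "dual_joint_eigenspace smul Q P 0 1 = dual_joint_eigenspace smul P Q 1 0"
    unfolding joint_eigenspace_def dual_joint_eigenspace_def by blast+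
  have "\<tau> = of_nat (vector_space.dim dual_scale (dual_joint_eigenspace smul P Q 1 0)) -
      of_nat (dim (joint_eigenspace smul P Q 0 1))"
    using QP(3) unfolding swap by (metis minus_diff_eq minus_minus)
  then show ?thesis using PQ QP(1,2) unfolding swap \<tau>_def by blast
qed

end
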